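(* Let $N>3$ be an integer and let \[ S_N = \left\{\{i,j\}\subseteq [N] \;\middle|\; i\neq j,\ \{i,j\}\subseteq \{1,\dots,\lfloor N/2\rfloor\} \text{ or } \{i,j\}\subseteq\{\lfloor N/2\rfloor+1,\dots,N\}\right\},\qquad \mathcal{C}_N = \{A_S^N \mid S\in S_N\}. \] Then $\mathcal{C}_N$ is a clique cover of $J(N,3)$. If moreover $N>7$, then $\mathcal{C}_N$ is a minimal clique cover, i.e. $|\mathcal{C}_N| = \theta(J(N,3))$.
   Context: For integers $0<k<N$, let $[N]=\{1,\dots,N\}$ and let $\mathcal{P}_k([N])$ be the set of $k$-element subsets of $[N]$. The Johnson graph $J(N,k)$ has vertex set $\mathcal{P}_k([N])$, two vertices $S_1,S_2$ being adjacent iff $|S_1\cap S_2| = k-1$. For $S\in\mathcal{P}_{k-1}([N])$, $A_S^N = \{S\cup\{x\}\mid x\in[N]\setminus S\}$, which is (the vertex set of) a clique in $J(N,k)$. A (vertex) clique cover of a graph $G$ is a collection of cliques of $G$ whose vertex sets together contain every vertex of $G$; $\theta(G)$ denotes the smallest cardinality of a clique cover of $G$, and a minimal clique cover is one of cardinality $\theta(G)$. *)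

theory Defs
  imports Main "Graph_Theory.Pair_Digraph"
begin

text \<open>Simple graphs are loop-free symmetric digraphs (locale \<^locale>\<open>pair_graph\<close>), each undirected
  edge being represented by its two arcs. A clique is identified with its vertex set.\<close>

definition is_clique :: "'a pair_pre_digraph \<Rightarrow> 'a set \<Rightarrow> bool" where
  "is_clique G K \<longleftrightarrow> K \<subseteq> pverts G \<and> (\<forall>u\<in>K. \<forall>v\<in>K. u \<noteq> v \<longrightarrow> (u, v) \<in> parcs G)"

definition clique_cover :: "'a pair_pre_digraph \<Rightarrow> 'a set set \<Rightarrow> bool" where
  "clique_cover G C \<longleftrightarrow> (\<forall>K\<in>C. is_clique G K) \<and> pverts G \<subseteq> \<Union>C"

text \<open>Finiteness is required because \<^const>\<open>card\<close> of an infinite set is 0; over a finite graph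
  it holds for every clique cover (\<open>finite_clique_cover\<close> below).\<close>

definition clique_cover_number :: "'a pair_pre_digraph \<Rightarrow> nat" (\<open>\<theta>\<close>) where
  "\<theta> G = (LEAST n. \<exists>C. clique_cover G C \<and> finite C \<and> card C = n)"

definition minimal_clique_cover :: "'a pair_pre_digraph \<Rightarrow> 'a set set \<Rightarrow> bool" where
  "minimal_clique_cover G C \<longleftrightarrow> clique_cover G C \<and> finite C \<and> card C = \<theta> G"

text \<open>For \<open>0 < k\<close>, \<open>card (S\<^sub>1 \<inter> S\<^sub>2) = k - 1\<close> already forces \<open>S\<^sub>1 \<noteq> S\<^sub>2\<close>.\<close>

definition johnson_graph :: "nat \<Rightarrow> nat \<Rightarrow> nat set pair_pre_digraph" where
  "johnson_graph N k =
    \<lparr> pverts = {S. S \<subseteq> {1..N} \<and> card S = k},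
      parcs = {(S\<^sub>1, S\<^sub>2). S\<^sub>1 \<subseteq> {1..N} \<and> card S\<^sub>1 = k \<and> S\<^sub>2 \<subseteq> {1..N} \<and> card S\<^sub>2 = k \<and>
                        card (S\<^sub>1 \<inter> S\<^sub>2) = k - 1} \<rparr>"

definition johnson_clique :: "nat \<Rightarrow> nat set \<Rightarrow> nat set set" where
  "johnson_clique N S = {S \<union> {x} | x. x \<in> {1..N} - S}"

definition half_pairs :: "nat \<Rightarrow> nat set set" where
  "half_pairs N = {{i, j} | i j. {i, j} \<subseteq> {1..N} \<and> i \<noteq> j \<and>
     ({i, j} \<subseteq> {1..N div 2} \<or> {i, j} \<subseteq> {N div 2 + 1..N})}"

definition half_pair_cover :: "nat \<Rightarrow> nat set set set" where
  "half_pair_cover N = {johnson_clique N S | S. S \<in> half_pairs N}"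

lemma pair_graph_johnson_graph:
  assumes "0 < k"
  shows "pair_graph (johnson_graph N k)"
proof -
  let ?G = "johnson_graph N k"
  have sub: "parcs ?G \<subseteq> pverts ?G \<times> pverts ?G"
    by (auto simp: johnson_graph_def)
  have fin: "finite (pverts ?G)"
    by (rule finite_subset[of _ "Pow {1..N}"]) (auto simp: johnson_graph_def)
  have fin_arcs: "finite (parcs ?G)"
    by (rule finite_subset[OF sub]) (simp add: fin)
  have no_loop: "fst e \<noteq> snd e" if "e \<in> parcs ?G" for e
  proof
    assume "fst e = snd e"
    with that have "card (fst e) = k" and "card (fst e) = k - 1"
      by (simp_all add: johnson_graph_def split_beta)
    with assms show False by linarith
  qed
  have sym: "symmetric (with_proj ?G)"
    by (simp add: symmetric_def sym_def johnson_graph_def Int_commute)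
  show ?thesis
    by unfold_locales (use sub fin fin_arcs no_loop sym in auto)
qed

lemma finite_clique_cover:
  assumes "finite (pverts G)" "clique_cover G C"
  shows "finite C"
  using assms
  by (intro finite_subset[of C "Pow (pverts G)"]) (auto simp: clique_cover_def is_clique_def)

lemma ex_finite_clique_cover:
  assumes "finite (pverts G)"
  shows "\<exists>C. clique_cover G C \<and> finite C"
  using assms
  by (intro exI[of _ "(\<lambda>v. {v}) ` pverts G"]) (auto simp: clique_cover_def is_clique_def)

end

theory Submission
  imports Defs
begin

text \<open>
  A clique of \<open>J(N,3)\<close> either consists of triples through a common pair or lives inside a
  4-element set, and then has at most 4 members. Given a clique cover, let \<open>G\<close> be the graph on
  \<open>[N]\<close> whose edges are the pairs not used by cliques of the first kind: every triangle of \<open>G\<close>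
  has to be covered by the \<open>t\<close> cliques of the second kind, so \<open>G\<close> has at most \<open>4t\<close> triangles.
  On the other hand, counting triangles over edges (every edge \<open>uv\<close> lies in at least
  \<open>d(u) + d(v) - N\<close> of them) shows that a graph with \<open>\<lfloor>N\<^sup>2/4\<rfloor> + s\<close> edges, \<open>s \<ge> 1\<close> and
  \<open>N \<ge> 8\<close>, has more than \<open>4(s - 1)\<close> triangles. Hence \<open>s \<le> t\<close>: a cover needs
  at least as many cliques as there are pairs outside a balanced complete bipartite graph on \<open>[N]\<close>.
\<close>

section \<open>Cliques of triples\<close>

text \<open>Let \<open>A\<close>, \<open>B\<close> be distinct members. A member avoiding the pair
  \<open>A \<inter> B\<close> lies in the 4-set \<open>A \<union> B\<close>. If one such member
  exists, all members lie in that 4-set, which has only four triples.\<close>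

lemma clique_of_triples:
  fixes K :: "'a set set"
  assumes triple: "\<And>A. A \<in> K \<Longrightarrow> card A = 3"
    and meet: "\<And>A B. A \<in> K \<Longrightarrow> B \<in> K \<Longrightarrow> A \<noteq> B \<Longrightarrow> card (A \<inter> B) = 2"
  shows "(\<exists>P. card P = 2 \<and> (\<forall>A\<in>K. P \<subseteq> A)) \<or> finite K \<and> card K \<le> 4"
proof (cases "\<exists>P. card P = 2 \<and> (\<forall>A\<in>K. P \<subseteq> A)")
  case False
  show ?thesis
  proof (cases "\<exists>A\<in>K. \<exists>B\<in>K. A \<noteq> B")
    case True
    then obtain A B where AB: "A \<in> K" "B \<in> K" "A \<noteq> B" by blast
    have fin: "finite X" if "X \<in> K" for X
      using triple[OF that] by (simp add: card_ge_0_finite)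
    have cAB: "card (A \<inter> B) = 2" using meet AB by blast
    have cU: "card (A \<union> B) = 4"
      using card_Un_Int[OF fin[OF AB(1)] fin[OF AB(2)]] triple[OF AB(1)] triple[OF AB(2)] cAB
      by simp
    have finU: "finite (A \<union> B)" using AB fin by blast
    have avoid: "X \<subseteq> A \<union> B" if X: "X \<in> K" "\<not> A \<inter> B \<subseteq> X" for X
    proof -
      have ne: "X \<noteq> A" "X \<noteq> B" using X(2) by auto
      have "card (X \<inter> A) = 2" "card (X \<inter> B) = 2" using meet X(1) AB ne by blast+
      moreover have "card (X \<inter> A \<union> X \<inter> B) + card (X \<inter> (A \<inter> B)) = card (X \<inter> A) + card (X \<inter> B)"
        using card_Un_Int[of "X \<inter> A" "X \<inter> B"] fin[OF X(1)] by (simp add: Int_ac)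
      moreover have "card (X \<inter> (A \<inter> B)) < 2"
      proof -
        have "X \<inter> (A \<inter> B) \<subset> A \<inter> B" using X(2) by blast
        then show ?thesis using psubset_card_mono cAB fin[OF AB(1)] by (metis finite_Int)
      qed
      \<comment> \<open>Two pairs inside \<open>X\<close> sharing at most one point cover at least 2
        + 2 - 1 = 3 points, hence all of \<open>X\<close>.\<close>
      ultimately have "card (X \<inter> A \<union> X \<inter> B) \<ge> card X" using triple[OF X(1)] by linarith
      then have "X \<inter> A \<union> X \<inter> B = X"
        by (intro card_seteq) (use fin[OF X(1)] in auto)
      then show ?thesis by blast
    qed
    obtain Y where Y: "Y \<in> K" "\<not> A \<inter> B \<subseteq> Y" using False cAB by blast
    have "X \<subseteq> A \<union> B" if X: "X \<in> K" for X
    proof (rule ccontr)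
      assume out: "\<not> X \<subseteq> A \<union> B"
      then have sub: "A \<inter> B \<subseteq> X" using avoid X by blast
      then obtain y where y: "y \<in> X" "y \<notin> A \<union> B" using out by blast
      \<comment> \<open>\<open>X\<close> is the pair plus an outside point \<open>y\<close>;
        \<open>Y\<close> misses \<open>y\<close> and part of the pair, so the two meet in fewer than
        two points.\<close>
      have "insert y (A \<inter> B) = X"
      proof (rule card_subset_eq[OF fin[OF X]])
        show "card (insert y (A \<inter> B)) = card X"
          using y cAB triple[OF X] fin[OF AB(1)] by simp
      qed (use y sub in blast)
      moreover have "Y \<subseteq> A \<union> B" using avoid Y by blast
      ultimately have "X \<inter> Y \<subset> A \<inter> B" using y Y(2) by blast
      then have "card (X \<inter> Y) < 2"
        using psubset_card_mono cAB fin[OF AB(1)] by (metis finite_Int)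
      moreover have "X \<noteq> Y" using sub Y(2) by blast
      ultimately show False using meet[OF X Y(1)] by simp
    qed
    then have sub: "K \<subseteq> {X. X \<subseteq> A \<union> B \<and> card X = 3}" using triple by blast
    have "card {X. X \<subseteq> A \<union> B \<and> card X = 3} = 4"
      using n_subsets[OF finU, of 3] cU by (simp add: numeral_eq_Suc)
    then show ?thesis
      using sub finU by (metis (lifting) card_gt_0_iff card_mono finite_subset zero_less_numeral)
  next
    case False
    then have "K = {} \<or> (\<exists>A. K = {A})" by blast
    then show ?thesis by auto
  qed
qed blast

section \<open>Counting triangles\<close>

text \<open>Triangles are vertex sets, so those of a graph on [N] are themselves vertices of
  J(N,3).\<close>

definition triangles :: "'a set \<Rightarrow> ('a \<Rightarrow> 'a \<Rightarrow> bool) \<Rightarrow> 'a set set" where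
  "triangles V E = {t. t \<subseteq> V \<and> card t = 3 \<and> (\<forall>x\<in>t. \<forall>y\<in>t. x \<noteq> y \<longrightarrow> E x y)}"

lemma card_ordered_triangles_le:
  assumes fin: "finite V" and irrefl: "\<And>u. \<not> E u u" and sym: "\<And>u v. E u v \<Longrightarrow> E v u"
  shows "card {(u, v, w). u \<in> V \<and> v \<in> V \<and> w \<in> V \<and> E u v \<and> E u w \<and> E v w} \<le> 6 * card (triangles V E)"
    (is "card ?O \<le> _")
proof -
  let ?F = "\<lambda>t. {(u, v, w). {u, v, w} = t} :: ('a \<times> 'a \<times> 'a) set"
  have fib: "finite (?F t) \<and> card (?F t) \<le> 6" if t: "t \<in> triangles V E" for t
  proof -
    obtain x y z where xyz: "t = {x, y, z}" "x \<noteq> y" "x \<noteq> z" "y \<noteq> z"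
      using t by (auto simp: triangles_def card_3_iff)
    \<comment> \<open>The length of a list bounds the number of its entries, so their distinctness
      need not be checked.\<close>
    let ?L = "[(x,y,z), (x,z,y), (y,x,z), (y,z,x), (z,x,y), (z,y,x)]"
    have sub: "?F t \<subseteq> set ?L"
    proof
      fix p assume "p \<in> ?F t"
      then obtain u v w where p: "p = (u, v, w)" and uvw: "{u, v, w} = t" by blast
      then have "card {u, v, w} = 3" using t by (simp add: triangles_def)
      then have "u \<noteq> v" "u \<noteq> w" "v \<noteq> w"
        by (auto simp: card_insert_if split: if_splits)
      moreover have "u \<in> {x, y, z}" "v \<in> {x, y, z}" "w \<in> {x, y, z}"
        using uvw xyz(1) by blast+
      ultimately show "p \<in> set ?L" using p by auto
    qed
    have "card (set ?L) \<le> 6" using card_length[of ?L] by simp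
    then show ?thesis
      using sub by (meson List.finite_set card_mono finite_subset le_trans)
  qed
  have finT: "finite (triangles V E)"
    by (rule finite_subset[of _ "Pow V"]) (use fin in \<open>auto simp: triangles_def\<close>)
  have "?O \<subseteq> (\<Union>t\<in>triangles V E. ?F t)"
  proof clarify
    fix u v w assume uvw: "u \<in> V" "v \<in> V" "w \<in> V" "E u v" "E u w" "E v w"
    then have "u \<noteq> v" "u \<noteq> w" "v \<noteq> w" using irrefl by auto
    then have "{u, v, w} \<in> triangles V E"
      using uvw sym by (auto simp: triangles_def)
    then show "(u, v, w) \<in> (\<Union>t\<in>triangles V E. ?F t)" by blast
  qed
  then have "card ?O \<le> card (\<Union>t\<in>triangles V E. ?F t)"
    by (rule card_mono[rotated]) (use finT fib in blast)
  also have "\<dots> \<le> (\<Sum>t\<in>triangles V E. card (?F t))" by (rule card_UN_le[OF finT])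
  also have "\<dots> \<le> (\<Sum>t\<in>triangles V E. 6)" by (rule sum_mono) (use fib in blast)
  finally show ?thesis by simp
qed

text \<open>Inclusion-exclusion bounds the common neighbours of \<open>u\<close> and
  \<open>v\<close> from below. Summed over ordered edges, this counts each triangle at most 6
  times.\<close>

lemma triangles_ge_degrees:
  fixes E :: "'a \<Rightarrow> 'a \<Rightarrow> bool"
  assumes fin: "finite V" and irrefl: "\<And>u. \<not> E u u" and sym: "\<And>u v. E u v \<Longrightarrow> E v u"
  defines "d \<equiv> \<lambda>v. int (card {u\<in>V. E v u})"
  shows "2 * (\<Sum>v\<in>V. d v * d v) - int (card V) * (\<Sum>v\<in>V. d v) \<le> 6 * int (card (triangles V E))"
proof -
  define nb where "nb = (\<lambda>v. {u\<in>V. E v u})"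
  have finnb: "finite (nb v)" for v using fin by (simp add: nb_def)
  have d: "d v = int (card (nb v))" for v by (simp add: d_def nb_def)
  have codeg: "d u + d v - int (card V) \<le> int (card (nb u \<inter> nb v))" for u v
  proof -
    have "card (nb u \<union> nb v) \<le> card V"
      by (rule card_mono) (use fin in \<open>auto simp: nb_def\<close>)
    then show ?thesis using card_Un_Int[OF finnb finnb, of u v] d by simp
  qed
  \<comment> \<open>Each \<open>d v\<close> is counted once for every neighbour of
    \<open>v\<close>.\<close>
  have swap: "(\<Sum>u\<in>V. \<Sum>v\<in>nb u. d v) = (\<Sum>v\<in>V. d v * d v)"
  proof -
    have "(\<Sum>u\<in>V. \<Sum>v\<in>nb u. d v) = (\<Sum>v\<in>V. \<Sum>u\<in>{u\<in>V. E u v}. d v)"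
      unfolding nb_def by (rule sum.swap_restrict[OF fin fin])
    also have "\<dots> = (\<Sum>v\<in>V. \<Sum>u\<in>nb v. d v)"
      by (intro sum.cong refl) (use sym in \<open>auto simp: nb_def\<close>)
    finally show ?thesis by (simp add: d)
  qed
  have "2 * (\<Sum>v\<in>V. d v * d v) - int (card V) * (\<Sum>v\<in>V. d v)
      = (\<Sum>u\<in>V. \<Sum>v\<in>nb u. d u + d v - int (card V))"
    using swap by (simp add: sum.distrib sum_subtractf sum_distrib_left d mult.commute)
  also have "\<dots> \<le> (\<Sum>u\<in>V. \<Sum>v\<in>nb u. int (card (nb u \<inter> nb v)))"
    by (intro sum_mono codeg)
  also have "\<dots> = int (card (SIGMA u:V. SIGMA v:nb u. nb u \<inter> nb v))"
    using fin finnb by simp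
  also have "(SIGMA u:V. SIGMA v:nb u. nb u \<inter> nb v)
      = {(u, v, w). u \<in> V \<and> v \<in> V \<and> w \<in> V \<and> E u v \<and> E u w \<and> E v w}"
    by (auto simp: nb_def)
  also have "int (card \<dots>) \<le> 6 * int (card (triangles V E))"
    using card_ordered_triangles_le[of V E, OF fin irrefl sym] by linarith
  finally show ?thesis .
qed

text \<open>No integer lies strictly between \<open>a\<close> and \<open>a + 1\<close>, so on
  integers the square stays above its chord through these two points. The slope can then be fitted
  to the average degree.\<close>

lemma sum_squares_ge_tangent:
  fixes d :: "'a \<Rightarrow> int"
  shows "(2 * a + 1) * (\<Sum>v\<in>V. d v) - int (card V) * (a * (a + 1)) \<le> (\<Sum>v\<in>V. d v * d v)"
proof -
  have "(2 * a + 1) * x - a * (a + 1) \<le> x * x" for x :: int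
  proof -
    have "0 \<le> (x - a) * (x - a - 1)" by (simp add: zero_le_mult_iff) linarith
    then show ?thesis by (simp add: algebra_simps)
  qed
  then have "(\<Sum>v\<in>V. (2 * a + 1) * d v - a * (a + 1)) \<le> (\<Sum>v\<in>V. d v * d v)"
    by (intro sum_mono)
  then show ?thesis by (simp add: sum_subtractf sum_distrib_left)
qed

text \<open>Each ordered pair of distinct vertices is an arc of the complement or one of at most two
  orientations of a member of \<open>S\<close>.\<close>

lemma sum_degrees_complement_ge:
  assumes fin: "finite V" and finS: "finite S"
  shows "int (card V) * (int (card V) - 1) - 2 * int (card S)
    \<le> (\<Sum>v\<in>V. int (card {u\<in>V. v \<noteq> u \<and> {v, u} \<notin> S}))"
proof -
  let ?A = "SIGMA v:V. {u\<in>V. v \<noteq> u \<and> {v, u} \<notin> S}"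
  let ?F = "\<lambda>P. {(v, u). v \<noteq> u \<and> {v, u} = P} :: ('a \<times> 'a) set"
  have fib: "finite (?F P) \<and> card (?F P) \<le> 2" for P :: "'a set"
  proof (cases "?F P = {}")
    case False
    then obtain x y where xy: "P = {x, y}" "x \<noteq> y" by auto
    have sub: "?F P \<subseteq> set [(x, y), (y, x)]"
      using xy by (auto simp: doubleton_eq_iff)
    have "card (set [(x, y), (y, x)]) \<le> 2" using card_length[of "[(x, y), (y, x)]"] by simp
    then show ?thesis using sub by (meson List.finite_set card_mono finite_subset le_trans)
  next
    case True
    show ?thesis unfolding True by simp
  qed
  have finA: "finite ?A" using fin by auto
  have "(SIGMA v:V. V - {v}) \<subseteq> ?A \<union> (\<Union>P\<in>S. ?F P)" by auto
  then have "card (SIGMA v:V. V - {v}) \<le> card (?A \<union> (\<Union>P\<in>S. ?F P))"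
    by (rule card_mono[rotated]) (use finA finS fib in blast)
  also have "\<dots> \<le> card ?A + card (\<Union>P\<in>S. ?F P)" by (rule card_Un_le)
  also have "card (\<Union>P\<in>S. ?F P) \<le> (\<Sum>P\<in>S. card (?F P))" by (rule card_UN_le[OF finS])
  also have "\<dots> \<le> (\<Sum>P\<in>S. 2)" by (rule sum_mono) (use fib in blast)
  finally have "int (card (SIGMA v:V. V - {v})) \<le> int (card ?A) + 2 * int (card S)" by simp
  moreover have "int (card (SIGMA v:V. V - {v})) = int (card V) * (int (card V) - 1)"
  proof (cases "V = {}")
    case False
    then have "card V \<ge> 1" using fin by (simp add: Suc_le_eq card_gt_0_iff)
    then show ?thesis using fin by (simp add: of_nat_diff)
  qed simp
  moreover have "int (card ?A) = (\<Sum>v\<in>V. int (card {u\<in>V. v \<noteq> u \<and> {v, u} \<notin> S}))"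
    using fin by simp
  ultimately show ?thesis by linarith
qed

text \<open>Here \<open>D\<close> is the sum of the degrees, \<open>T\<close> the number of triangles and \<open>s\<close> the excess of the
  number of edges over \<open>\<lfloor>N\<^sup>2/4\<rfloor>\<close>. Tangent points near the average degree suffice: \<open>N div 2\<close>
  for small excess and \<open>N div 2 + 1\<close> for large excess.\<close>

lemma triangle_excess:
  fixes D s T m :: int
  assumes tangent: "\<And>a. (4 * a + 2 - N) * D - 2 * N * (a * (a + 1)) \<le> 6 * T"
    and N: "N = 2 * m \<or> N = 2 * m + 1" and m: "m \<ge> 4" and s: "s \<ge> 1"
    and D: "D \<ge> 2 * (m * (N - m)) + 2 * s"
  shows "4 * s < T + 4"
  using N
proof
  assume N: "N = 2 * m"
  show ?thesis
  \<comment> \<open>Taking \<open>a = m\<close> gives \<open>20 * s \<le> 6 * T\<close>, enough for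
    \<open>s \<le> 5\<close>. Taking \<open>a = m + 1\<close> is enough from \<open>s = 3\<close>
    on, but at \<open>s = 2\<close> it misses the strict inequality.\<close>
  proof (cases "s \<le> 2")
    case True
    have "(2 * m + 2) * (2 * (m * m) + 2 * s) \<le> (2 * m + 2) * D"
      by (rule mult_left_mono) (use D N m in auto)
    moreover have "(2 * m + 2) * D - 4 * m * (m * (m + 1)) \<le> 6 * T"
      using tangent[of m] N by simp
    ultimately have "(4 * m + 4) * s \<le> 6 * T" by (simp add: algebra_simps)
    moreover have "20 * s \<le> (4 * m + 4) * s"
      by (rule mult_right_mono) (use m s in auto)
    ultimately have "20 * s \<le> 6 * T" by linarith
    then show ?thesis using True by linarith
  next
    case False
    have "(2 * m + 6) * (2 * (m * m) + 2 * s) \<le> (2 * m + 6) * D"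
      by (rule mult_left_mono) (use D N m in auto)
    moreover have "(2 * m + 6) * D - 4 * m * ((m + 1) * (m + 2)) \<le> 6 * T"
      using tangent[of "m + 1"] N by (simp add: algebra_simps)
    ultimately have "(4 * m + 12) * s - 8 * m \<le> 6 * T" by (simp add: algebra_simps)
    moreover have "(4 * m - 12) * 3 \<le> (4 * m - 12) * s"
      by (rule mult_left_mono) (use m False in auto)
    ultimately show ?thesis using m by (simp add: algebra_simps)
  qed
next
  assume N: "N = 2 * m + 1"
  \<comment> \<open>For odd \<open>N\<close> the point \<open>a = m + 1\<close> already works at
    \<open>s = 1\<close>, and the slack grows with \<open>s\<close>.\<close>
  have "(2 * m + 5) * (2 * (m * (m + 1)) + 2 * s) \<le> (2 * m + 5) * D"
    by (rule mult_left_mono) (use D N m in \<open>auto simp: algebra_simps\<close>)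
  moreover have "(2 * m + 5) * D - 2 * (2 * m + 1) * ((m + 1) * (m + 2)) \<le> 6 * T"
    using tangent[of "m + 1"] N by (simp add: algebra_simps)
  ultimately have "(4 * m + 10) * s - 4 * m - 4 \<le> 6 * T" by (simp add: algebra_simps)
  moreover have "(4 * m - 14) * 1 \<le> (4 * m - 14) * s"
    by (rule mult_left_mono) (use m s in auto)
  ultimately show ?thesis using m by (simp add: algebra_simps)
qed

text \<open>If the bound failed, the excess \<open>s\<close> would be at least \<open>t + 1\<close>,
  giving more than \<open>4 * (s - 1) \<ge> 4 * t\<close> triangles.\<close>

lemma pairs_and_triangles_ge:
  fixes V :: "'a set"
  assumes fin: "finite V" and finS: "finite S" and V: "card V \<ge> 8"
    and T: "card (triangles V (\<lambda>u v. u \<noteq> v \<and> {u, v} \<notin> S)) \<le> 4 * t"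
  shows "(card V div 2 choose 2) + (card V - card V div 2 choose 2) \<le> card S + t"
proof (rule ccontr)
  assume less: "\<not> ?thesis"
  define N m where "N = int (card V)" and "m = int (card V div 2)"
  define b where "b = (card V div 2 choose 2) + (card V - card V div 2 choose 2)"
  define s where "s = int b - int (card S)"
  let ?E = "\<lambda>u v. u \<noteq> v \<and> {u, v} \<notin> S"
  let ?D = "\<Sum>v\<in>V. int (card {u\<in>V. ?E v u})"
  have ch: "2 * int (n choose 2) = int n * (int n - 1)" for n :: nat
  proof (cases n)
    case (Suc k)
    have "even (n * (n - 1))" by (simp add: Suc)
    then have "2 * (n choose 2) = n * (n - 1)" by (simp only: choose_two dvd_mult_div_cancel)
    then have "2 * int (n choose 2) = int n * int (n - 1)" by (metis of_nat_mult of_nat_numeral)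
    then show ?thesis by (simp add: Suc)
  qed simp
  have nm: "int (card V - card V div 2) = N - m"
    by (simp add: N_def m_def of_nat_diff)
  have b2: "2 * int b = m * (m - 1) + (N - m) * (N - m - 1)"
    using ch[of "card V div 2"] ch[of "card V - card V div 2"] nm
    by (simp add: b_def m_def)
  have parity: "N = 2 * m \<or> N = 2 * m + 1"
    unfolding N_def m_def by linarith
  have "4 * s < int (card (triangles V ?E)) + 4"
  proof (rule triangle_excess[of N ?D _ m])
    fix a :: int
    let ?d = "\<lambda>v. int (card {u\<in>V. ?E v u})"
    have "2 * (\<Sum>v\<in>V. ?d v * ?d v) - N * ?D \<le> 6 * int (card (triangles V ?E))"
      unfolding N_def by (rule triangles_ge_degrees[OF fin]) (auto simp: insert_commute)
    moreover have "(2 * a + 1) * ?D - N * (a * (a + 1)) \<le> (\<Sum>v\<in>V. ?d v * ?d v)"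
      unfolding N_def by (rule sum_squares_ge_tangent)
    ultimately show "(4 * a + 2 - N) * ?D - 2 * N * (a * (a + 1)) \<le> 6 * int (card (triangles V ?E))"
      by (simp add: algebra_simps)
  next
    \<comment> \<open>All pairs split into the \<open>b\<close> pairs inside the two parts and the
      \<open>m * (N - m)\<close> pairs across.\<close>
    have "N * (N - 1) - 2 * int (card S) = 2 * (m * (N - m)) + 2 * s"
      using b2 by (simp add: s_def algebra_simps)
    then show "?D \<ge> 2 * (m * (N - m)) + 2 * s"
      using sum_degrees_complement_ge[OF fin finS] by (simp add: N_def)
  qed (use parity V less in \<open>auto simp: m_def s_def b_def\<close>)
  moreover have "int t + 1 \<le> s" using less by (simp add: s_def b_def)
  ultimately show False using T by linarith
qed

section \<open>Clique covers of the Johnson graph\<close>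

lemma card_clique_cover_johnson_ge:
  assumes N: "N \<ge> 8" and cov: "clique_cover (johnson_graph N 3) C" and fin: "finite C"
  shows "(N div 2 choose 2) + (N - N div 2 choose 2) \<le> card C"
proof -
  define star where "star = (\<lambda>K P :: nat set. card P = 2 \<and> (\<forall>A\<in>K. P \<subseteq> A))"
  define C1 where "C1 = {K\<in>C. \<exists>P. star K P}"
  \<comment> \<open>One common pair is chosen per star, the empty clique and singletons included.
    Stars may share a pair, hence only \<open>card S \<le> card C1\<close>.\<close>
  define S where "S = (\<lambda>K. SOME P. star K P) ` C1"
  let ?T = "triangles {1..N} (\<lambda>u v. u \<noteq> v \<and> {u, v} \<notin> S)"
  have small: "finite K \<and> card K \<le> 4" if "K \<in> C - C1" for K
  proof -
    have K: "is_clique (johnson_graph N 3) K" and nostar: "\<not> (\<exists>P. star K P)"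
      using that cov by (auto simp: clique_cover_def C1_def)
    have "(\<exists>P. card P = 2 \<and> (\<forall>A\<in>K. P \<subseteq> A)) \<or> finite K \<and> card K \<le> 4"
      by (rule clique_of_triples) (use K in \<open>auto simp: is_clique_def johnson_graph_def\<close>)
    then show ?thesis using nostar by (auto simp: star_def)
  qed
  have "?T \<subseteq> \<Union>(C - C1)"
  proof
    fix A assume A: "A \<in> ?T"
    then have "A \<in> pverts (johnson_graph N 3)"
      by (auto simp: triangles_def johnson_graph_def)
    then obtain K where K: "K \<in> C" "A \<in> K" using cov by (auto simp: clique_cover_def)
    have "K \<notin> C1"
    proof
      assume K1: "K \<in> C1"
      define P where "P = (SOME P. star K P)"
      have "star K P" using K1 unfolding P_def C1_def by (auto intro: someI)
      then have P: "card P = 2" "P \<subseteq> A" using K by (auto simp: star_def)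
      have "P \<in> S" using K1 by (auto simp: S_def P_def)
      moreover obtain x y where "P = {x, y}" "x \<noteq> y" using P(1) by (auto simp: card_2_iff)
      ultimately show False using A P(2) by (auto simp: triangles_def)
    qed
    then show "A \<in> \<Union>(C - C1)" using K by blast
  qed
  then have "card ?T \<le> card (\<Union>(C - C1))"
    by (rule card_mono[rotated]) (use fin small in auto)
  also have "\<dots> \<le> (\<Sum>K\<in>C - C1. card K)"
    using card_UN_le[of "C - C1" "\<lambda>K. K"] fin by simp
  also have "\<dots> \<le> (\<Sum>K\<in>C - C1. 4)" by (rule sum_mono) (use small in blast)
  finally have T: "card ?T \<le> 4 * card (C - C1)" by simp
  have sub: "C1 \<subseteq> C" by (auto simp: C1_def)
  then have fin1: "finite C1" using fin finite_subset by blast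
  have "(N div 2 choose 2) + (N - N div 2 choose 2) \<le> card S + card (C - C1)"
    using pairs_and_triangles_ge[of "{1..N}" S, OF _ _ _ T] N fin1 by (simp add: S_def)
  also have "\<dots> \<le> card C1 + card (C - C1)"
    using card_image_le[OF fin1] by (simp add: S_def)
  also have "\<dots> = card C"
    using card_Diff_subset[OF fin1 sub] card_mono[OF fin sub] by simp
  finally show ?thesis .
qed

section \<open>Size and covering property of the half-pair cover\<close>

lemma half_pairs_eq:
  "half_pairs N = {P. P \<subseteq> {1..N div 2} \<and> card P = 2} \<union> {P. P \<subseteq> {N div 2 + 1..N} \<and> card P = 2}"
proof -
  have "P \<in> half_pairs N \<longleftrightarrow> card P = 2 \<and> (P \<subseteq> {1..N div 2} \<or> P \<subseteq> {N div 2 + 1..N})" for P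
  proof -
    have "{1..N div 2} \<subseteq> {1..N}" "{N div 2 + 1..N} \<subseteq> {1..N}" by auto
    then show ?thesis
      unfolding half_pairs_def card_2_iff mem_Collect_eq by blast
  qed
  then show ?thesis by blast
qed

lemma finite_half_pairs: "finite (half_pairs N)"
  by (simp add: half_pairs_eq)

text \<open>An upper bound suffices: equality follows from the lower bound valid for every
  cover.\<close>

lemma card_half_pair_cover_le:
  "card (half_pair_cover N) \<le> (N div 2 choose 2) + (N - N div 2 choose 2)"
proof -
  have "half_pair_cover N = johnson_clique N ` half_pairs N"
    by (auto simp: half_pair_cover_def)
  then have "card (half_pair_cover N) \<le> card (half_pairs N)"
    using card_image_le[OF finite_half_pairs] by simp
  also have "\<dots> \<le> card {P. P \<subseteq> {1..N div 2} \<and> card P = 2} + card {P. P \<subseteq> {N div 2 + 1..N} \<and> card P = 2}"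
    unfolding half_pairs_eq by (rule card_Un_le)
  finally show ?thesis by (simp add: n_subsets)
qed

lemma is_clique_johnson_clique:
  assumes S: "S \<subseteq> {1..N}" "card S = k - 1" and k: "0 < k"
  shows "is_clique (johnson_graph N k) (johnson_clique N S)"
proof -
  have fin: "finite S" using S(1) finite_subset by blast
  have "(S \<union> {x}) \<inter> (S \<union> {y}) = S" if "x \<noteq> y" "x \<notin> S" for x y using that by blast
  moreover have "card (S \<union> {x}) = k" if "x \<notin> S" for x using that fin S k by simp
  ultimately show ?thesis
    using S unfolding is_clique_def johnson_clique_def johnson_graph_def by fastforce
qed

text \<open>Two of the three elements of a vertex lie in the same half; they form the half pair
  \<open>S\<close> of a clique containing that vertex.\<close>

lemma clique_cover_half_pair_cover: "clique_cover (johnson_graph N 3) (half_pair_cover N)"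
  unfolding clique_cover_def
proof
  show "\<forall>K\<in>half_pair_cover N. is_clique (johnson_graph N 3) K"
  proof
    fix K assume "K \<in> half_pair_cover N"
    then obtain S where S: "K = johnson_clique N S" "S \<in> half_pairs N"
      by (auto simp: half_pair_cover_def)
    then have "S \<subseteq> {1..N}" "card S = 2"
      by (auto simp: half_pairs_def)
    then show "is_clique (johnson_graph N 3) K"
      using is_clique_johnson_clique[of S N 3] S by simp
  qed
  show "pverts (johnson_graph N 3) \<subseteq> \<Union>(half_pair_cover N)"
  proof
    fix A assume "A \<in> pverts (johnson_graph N 3)"
    then have A: "A \<subseteq> {1..N}" "card A = 3" by (auto simp: johnson_graph_def)
    have pigeonhole: "\<exists>x\<in>A. A - {x} \<in> half_pairs N"
    proof -
      obtain x y z where A_eq: "A = {x, y, z}" and ne: "x \<noteq> y" "x \<noteq> z" "y \<noteq> z"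
        using A(2) by (auto simp: card_3_iff)
      have diff: "A - {x} = {y, z}" "A - {y} = {x, z}" "A - {z} = {x, y}"
        using A_eq ne by auto
      have half: "{u, v} \<in> half_pairs N"
        if "u \<in> A" "v \<in> A" "u \<noteq> v" "u \<le> N div 2 \<longleftrightarrow> v \<le> N div 2" for u v
        using that A(1) unfolding half_pairs_eq by auto
      show ?thesis
        using half[of x y] half[of x z] half[of y z] diff A_eq ne by auto
    qed
    then obtain x where x: "x \<in> A" "A - {x} \<in> half_pairs N" by blast
    then have "A \<in> johnson_clique N (A - {x})"
      using A(1) unfolding johnson_clique_def by blast
    then show "A \<in> \<Union>(half_pair_cover N)"
      using x(2) by (auto simp: half_pair_cover_def)
  qed
qed

theorem theorem2p6:
  fixes N :: nat
  assumes "N > 3"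
  shows "clique_cover (johnson_graph N 3) (half_pair_cover N) \<and>
         (N > 7 \<longrightarrow> minimal_clique_cover (johnson_graph N 3) (half_pair_cover N))"
proof (intro conjI impI)
  let ?G = "johnson_graph N 3" and ?C = "half_pair_cover N"
  show cov: "clique_cover ?G ?C" by (rule clique_cover_half_pair_cover)
  assume N: "N > 7"
  let ?Q = "\<lambda>n. \<exists>C. clique_cover ?G C \<and> finite C \<and> card C = n"
  have fin: "finite ?C"
    using finite_half_pairs by (simp add: half_pair_cover_def)
  then have Q: "?Q (card ?C)" using cov by blast
  have "\<theta> ?G \<le> card ?C"
    unfolding clique_cover_number_def by (rule Least_le[of ?Q, OF Q])
  \<comment> \<open>The half-pair cover witnesses that the \<open>LEAST\<close> is attained, so the
    lower bound can be applied to an optimal cover.\<close>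
  moreover obtain C where "clique_cover ?G C" "finite C" "card C = \<theta> ?G"
    using LeastI[of ?Q, OF Q] unfolding clique_cover_number_def by blast
  then have "card ?C \<le> \<theta> ?G"
    using card_clique_cover_johnson_ge[of N C] card_half_pair_cover_le[of N] N by simp
  ultimately show "minimal_clique_cover ?G ?C"
    using cov fin by (simp add: minimal_clique_cover_def)
qed

end
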